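(* Let $T=(V,E)$ be a rooted, leafless, locally finite directed tree with root $o$, let $1<p<\infty$, and let $\lambda=(\lambda_u)_{u\in V\setminus\{o\}}$ be a family of complex weights. Then the weighted backward shift $B_\lambda$ is bounded on $\operatorname{Ces}_p(T)$ if and only if $$L_\lambda:=\sup_{r\ge 0}\frac{c_{r+1}}{c_r}\max_{u\in D_{r+1}}|\lambda_u|<\infty.$$ Moreover (in this case), $$L_\lambda\le \|B_\lambda\|\le 2L_\lambda,$$ where $\|B_\lambda\|$ is the operator norm of $B_\lambda$ on $\operatorname{Ces}_p(T)$.
   Context: Trees. A directed tree $T=(V,E)$ has a countably infinite vertex set $V$ and edge set $E\subseteq V\times V$ such that the underlying undirected graph is connected and has no cycles, and every vertex has at most one parent (a parent of $v$ is a vertex $w$ with $(w,v)\in E$). It is rooted if it has a unique vertex $o$ (the root) without a parent. The parent of $v\ne o$ is $\operatorname{par}(v)$; the set of children of $v$ is $\operatorname{Chi}(v)=\{u\in V:(v,u)\in E\}$. The tree is locally finite if every $\operatorname{Chi}(v)$ is finite, and leafless if every $\operatorname{Chi}(v)$ is nonempty. For $v\in V$, $|v|$ is the length of the unique path from $o$ to $v$; $D_n=\{v\in V:|v|=n\}$ and $c_n=|D_n|$ (cardinality) for $n\in\mathbb N_0$. Ces\`aro space. For $f:V\to\mathbb C$ put $A_n(f)=\frac1{c_n}\sum_{v\in D_n}|f(v)|$. For $1<p<\infty$, $\operatorname{Ces}_p(T)$ is the space of all $f:V\to\mathbb C$ with $$\|f\|_{\operatorname{Ces}_p(T)}=\Biggl[\sum_{n=0}^\infty\biggl(\frac1{n+1}\sum_{r=0}^nA_r(f)\biggr)^p\Biggr]^{1/p}<\infty;$$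 it is a Banach space with this norm. Weighted backward shift. For $f:V\to\mathbb C$, $B_\lambda f(v)=\sum_{u\in\operatorname{Chi}(v)}\lambda_uf(u)$, $v\in V$. "Bounded on $\operatorname{Ces}_p(T)$" means that $B_\lambda$ maps $\operatorname{Ces}_p(T)$ into itself as a bounded linear operator. *)

theory Defs
  imports Complex_Main "HOL-Library.Countable_Set" "HOL-Library.Extended_Real"
begin

section \<open>Directed trees\<close>

definition adjacent :: "('v \<times> 'v) set \<Rightarrow> 'v \<Rightarrow> 'v \<Rightarrow> bool" where
  "adjacent E u v \<longleftrightarrow> (u, v) \<in> E \<or> (v, u) \<in> E"

definition ugraph_connected :: "'v set \<Rightarrow> ('v \<times> 'v) set \<Rightarrow> bool" where
  "ugraph_connected V E \<longleftrightarrow> (\<forall>u\<in>V. \<forall>v\<in>V. (adjacent E)\<^sup>*\<^sup>* u v)"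

text \<open>
  The first two conjuncts exclude cycles of length one (loops) and of length two
  (pairs of opposite edges), the third one excludes longer cycles.
\<close>

definition ugraph_no_cycles :: "('v \<times> 'v) set \<Rightarrow> bool" where
  "ugraph_no_cycles E \<longleftrightarrow>
     (\<forall>v. (v, v) \<notin> E) \<and>
     (\<forall>u v. (u, v) \<in> E \<longrightarrow> (v, u) \<notin> E) \<and>
     \<not> (\<exists>xs. 3 \<le> length xs \<and> distinct xs \<and> successively (adjacent E) xs \<and>
            adjacent E (last xs) (hd xs))"

definition directed_tree :: "'v set \<Rightarrow> ('v \<times> 'v) set \<Rightarrow> bool" where
  "directed_tree V E \<longleftrightarrow>
     countable V \<and> infinite V \<and> E \<subseteq> V \<times> V \<and>
     ugraph_connected V E \<and> ugraph_no_cycles E \<and>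
     (\<forall>v w w'. (w, v) \<in> E \<and> (w', v) \<in> E \<longrightarrow> w = w')"

definition is_tree_root :: "'v set \<Rightarrow> ('v \<times> 'v) set \<Rightarrow> 'v \<Rightarrow> bool" where
  "is_tree_root V E v \<longleftrightarrow> v \<in> V \<and> \<not> (\<exists>w. (w, v) \<in> E)"

definition rooted :: "'v set \<Rightarrow> ('v \<times> 'v) set \<Rightarrow> bool" where
  "rooted V E \<longleftrightarrow> (\<exists>!v. is_tree_root V E v)"

definition tree_root :: "'v set \<Rightarrow> ('v \<times> 'v) set \<Rightarrow> 'v" where
  "tree_root V E = (THE v. is_tree_root V E v)"

definition children :: "('v \<times> 'v) set \<Rightarrow> 'v \<Rightarrow> 'v set" where
  "children E v = {u. (v, u) \<in> E}"

definition locally_finite_tree :: "'v set \<Rightarrow> ('v \<times> 'v) set \<Rightarrow> bool" where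
  "locally_finite_tree V E \<longleftrightarrow> (\<forall>v\<in>V. finite (children E v))"

definition leafless :: "'v set \<Rightarrow> ('v \<times> 'v) set \<Rightarrow> bool" where
  "leafless V E \<longleftrightarrow> (\<forall>v\<in>V. children E v \<noteq> {})"

text \<open>
  The length of the unique path from the root: in a rooted directed tree all edges point
  away from the root, so this path is directed and \<open>E ^^ n\<close> relates its end points
  for exactly one \<open>n\<close>.
\<close>

definition depth :: "'v set \<Rightarrow> ('v \<times> 'v) set \<Rightarrow> 'v \<Rightarrow> nat" where
  "depth V E v = (THE n. (tree_root V E, v) \<in> E ^^ n)"

definition level :: "'v set \<Rightarrow> ('v \<times> 'v) set \<Rightarrow> nat \<Rightarrow> 'v set" where
  "level V E n = {v \<in> V. depth V E v = n}"

definition level_card :: "'v set \<Rightarrow> ('v \<times> 'v) set \<Rightarrow> nat \<Rightarrow> nat" where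
  "level_card V E n = card (level V E n)"


section \<open>The Cesaro space of a tree\<close>

definition level_avg :: "'v set \<Rightarrow> ('v \<times> 'v) set \<Rightarrow> nat \<Rightarrow> ('v \<Rightarrow> complex) \<Rightarrow> real" where
  "level_avg V E n f = (1 / real (level_card V E n)) * (\<Sum>v\<in>level V E n. cmod (f v))"

definition ces_mean :: "'v set \<Rightarrow> ('v \<times> 'v) set \<Rightarrow> nat \<Rightarrow> ('v \<Rightarrow> complex) \<Rightarrow> real" where
  "ces_mean V E n f = (1 / (real n + 1)) * (\<Sum>r\<le>n. level_avg V E r f)"

text \<open>
  A function on \<open>V\<close> is represented by its extension by zero to the whole type.
\<close>

definition Ces :: "real \<Rightarrow> 'v set \<Rightarrow> ('v \<times> 'v) set \<Rightarrow> ('v \<Rightarrow> complex) set" where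
  "Ces p V E = {f. (\<forall>v. v \<notin> V \<longrightarrow> f v = 0) \<and> summable (\<lambda>n. ces_mean V E n f powr p)}"

definition Ces_norm :: "real \<Rightarrow> 'v set \<Rightarrow> ('v \<times> 'v) set \<Rightarrow> ('v \<Rightarrow> complex) \<Rightarrow> real" where
  "Ces_norm p V E f = (\<Sum>n. ces_mean V E n f powr p) powr (1 / p)"


section \<open>Operators\<close>

definition bounded_operator_on ::
  "('v \<Rightarrow> complex) set \<Rightarrow> (('v \<Rightarrow> complex) \<Rightarrow> real) \<Rightarrow> (('v \<Rightarrow> complex) \<Rightarrow> ('v \<Rightarrow> complex)) \<Rightarrow> bool"
  where
  "bounded_operator_on X N T \<longleftrightarrow>
     (\<forall>f\<in>X. T f \<in> X) \<and>
     (\<forall>f\<in>X. \<forall>g\<in>X. T (\<lambda>v. f v + g v) = (\<lambda>v. T f v + T g v)) \<and>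
     (\<forall>c. \<forall>f\<in>X. T (\<lambda>v. c * f v) = (\<lambda>v. c * T f v)) \<and>
     (\<exists>C. \<forall>f\<in>X. N (T f) \<le> C * N f)"

text \<open>Only meaningful for bounded operators, for which the supremum is that of a bounded set.\<close>

definition operator_norm_on ::
  "('v \<Rightarrow> complex) set \<Rightarrow> (('v \<Rightarrow> complex) \<Rightarrow> real) \<Rightarrow> (('v \<Rightarrow> complex) \<Rightarrow> ('v \<Rightarrow> complex)) \<Rightarrow> real"
  where
  "operator_norm_on X N T = Sup {N (T f) | f. f \<in> X \<and> N f \<le> 1}"

text \<open>
  The weight at the root is never used, since the root is not a child of any vertex.
  Vertices outside \<open>V\<close> have no children, so the result vanishes there.
\<close>

definition backward_shift ::
  "('v \<times> 'v) set \<Rightarrow> ('v \<Rightarrow> complex) \<Rightarrow> ('v \<Rightarrow> complex) \<Rightarrow> ('v \<Rightarrow> complex)" where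
  "backward_shift E lam f = (\<lambda>v. \<Sum>u\<in>children E v. lam u * f u)"

definition shift_const :: "'v set \<Rightarrow> ('v \<times> 'v) set \<Rightarrow> ('v \<Rightarrow> complex) \<Rightarrow> ereal" where
  "shift_const V E lam =
     (SUP r. ereal (real (level_card V E (Suc r)) / real (level_card V E r) *
                    Max ((\<lambda>u. cmod (lam u)) ` level V E (Suc r))))"

end

theory Submission
  imports Defs "HOL-Analysis.Summation_Tests"
begin

text \<open>
  Every level of the tree is a finite nonempty set, and the level \<open>r + 1\<close> is the disjoint
  union of the sets of children of the vertices of level \<open>r\<close>.  Writing
  \<open>w\<^sub>r = (c\<^sub>r\<^sub>+\<^sub>1 / c\<^sub>r) * max |\<lambda>\<^sub>u|\<close> (maximum over the level \<open>r + 1\<close>),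
  the triangle inequality therefore gives \<open>A\<^sub>r (B f) \<le> w\<^sub>r * A\<^sub>r\<^sub>+\<^sub>1 f\<close>.

  Upper bound.  If all \<open>w\<^sub>r\<close> are at most \<open>L\<close>, the \<open>n\<close>-th Cesaro mean of \<open>B f\<close> is at
  most \<open>L * (n + 2) / (n + 1)\<close> times the Cesaro mean of \<open>f\<close> with index \<open>n + 1\<close>.
  The factor \<open>(n + 2) / (n + 1)\<close> is at most \<open>2\<close>, and shifting the index can only decrease the
  \<open>p\<close>-sum, so that \<open>\<parallel>B f\<parallel> \<le> 2 L \<parallel>f\<parallel>\<close>.

  Lower bound.  For a vertex \<open>u\<close> of level \<open>r + 1\<close> with parent \<open>v\<close>, the shift maps the
  indicator function of \<open>u\<close> to \<open>\<lambda>\<^sub>u\<close> times that of \<open>v\<close>.  The Cesaro means of the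
  indicator of \<open>u\<close> are \<open>1 / (c\<^sub>r\<^sub>+\<^sub>1 (n + 1))\<close> from \<open>n = r + 1\<close> on and \<open>0\<close> before;
  those of the indicator of \<open>v\<close> are \<open>1 / (c\<^sub>r (n + 1))\<close> already from \<open>n = r\<close> on.
  Hence \<open>|\<lambda>\<^sub>u| c\<^sub>r\<^sub>+\<^sub>1 / c\<^sub>r\<close> times the former sequence lies below the Cesaro means of the
  image, and \<open>\<parallel>B\<parallel> \<ge> |\<lambda>\<^sub>u| c\<^sub>r\<^sub>+\<^sub>1 / c\<^sub>r\<close>.  Indicators belong to the space because
  \<open>p > 1\<close> makes \<open>(n + 1) powr - p\<close> summable.
\<close>

section \<open>Operator norms\<close>

text \<open>
  The supremum in the operator norm runs over the unit ball; a general \<open>f\<close> is moved into the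
  ball by dividing it by its norm, so only homogeneity of the norm enters.
\<close>

lemma operator_norm_on_bound:
  assumes bounded: "bounded_operator_on X N T"
    and nonneg: "\<And>f. f \<in> X \<Longrightarrow> 0 \<le> N f"
    and scale: "\<And>c f. f \<in> X \<Longrightarrow> (\<lambda>v. c * f v) \<in> X"
    and homogeneous: "\<And>c f. f \<in> X \<Longrightarrow> N (\<lambda>v. c * f v) = cmod c * N f"
    and "f \<in> X" and pos: "0 < N f"
  shows "N (T f) \<le> operator_norm_on X N T * N f"
proof -
  let ?S = "{N (T f) | f. f \<in> X \<and> N f \<le> 1}"
  obtain C where C: "\<And>g. g \<in> X \<Longrightarrow> N (T g) \<le> C * N g"
    using bounded unfolding bounded_operator_on_def by blast
  have "N (T g) \<le> \<bar>C\<bar>" if "g \<in> X" "N g \<le> 1" for g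
  proof -
    have "C * N g \<le> \<bar>C\<bar> * N g"
      using nonneg[OF that(1)] by (intro mult_right_mono) auto
    also have "\<dots> \<le> \<bar>C\<bar> * 1"
      using that(2) by (intro mult_left_mono) auto
    finally show ?thesis
      using C[OF that(1)] by simp
  qed
  then have bdd: "bdd_above ?S"
    by (intro bdd_aboveI[of _ "\<bar>C\<bar>"]) auto
  define c where "c = complex_of_real (1 / N f)"
  have cmod_c: "cmod c = 1 / N f"
    using pos by (simp add: c_def norm_divide)
  have T_scale: "T (\<lambda>v. c * f v) = (\<lambda>v. c * T f v)" and T_f: "T f \<in> X"
    using bounded \<open>f \<in> X\<close> unfolding bounded_operator_on_def by blast+
  have "N (\<lambda>v. c * f v) \<le> 1"
    using pos by (simp add: homogeneous[OF \<open>f \<in> X\<close>] cmod_c)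
  then have "N (T (\<lambda>v. c * f v)) \<in> ?S"
    using scale[OF \<open>f \<in> X\<close>] by blast
  then have "N (T (\<lambda>v. c * f v)) \<le> operator_norm_on X N T"
    unfolding operator_norm_on_def using bdd by (rule cSup_upper)
  then show ?thesis
    using pos by (simp add: T_scale homogeneous[OF T_f] cmod_c field_simps)
qed

section \<open>Levels of a rooted tree\<close>

locale leafless_rooted_tree =
  fixes V :: "'v set" and E :: "('v \<times> 'v) set"
  assumes directed_tree: "directed_tree V E"
    and rooted: "rooted V E"
    and leafless: "leafless V E"
    and locally_finite: "locally_finite_tree V E"
begin

lemma root_in_V: "tree_root V E \<in> V"
  and root_no_parent: "(w, tree_root V E) \<notin> E"
proof -
  have "is_tree_root V E (tree_root V E)"
    using rooted unfolding rooted_def tree_root_def by (rule theI')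
  then show "tree_root V E \<in> V" and "(w, tree_root V E) \<notin> E"
    unfolding is_tree_root_def by blast+
qed

lemma edge_in_V: "(v, w) \<in> E \<Longrightarrow> v \<in> V \<and> w \<in> V"
  using directed_tree unfolding directed_tree_def by blast

lemma parent_unique: "(w, v) \<in> E \<Longrightarrow> (w', v) \<in> E \<Longrightarrow> w = w'"
  using directed_tree unfolding directed_tree_def by blast

text \<open>
  An undirected path from the root never has to use an edge backwards: the vertex that such a
  step leaves was entered from its only parent, which is the vertex the step goes to.
\<close>

lemma reachable_from_root:
  assumes "v \<in> V"
  shows "\<exists>n. (tree_root V E, v) \<in> E ^^ n"
proof -
  have "(adjacent E)\<^sup>*\<^sup>* (tree_root V E) v"
    using directed_tree assms root_in_V
    unfolding directed_tree_def ugraph_connected_def by blast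
  then show ?thesis
  proof (induction rule: rtranclp_induct)
    case base
    have "(tree_root V E, tree_root V E) \<in> E ^^ 0" by simp
    then show ?case by blast
  next
    case (step y z)
    then obtain n where n: "(tree_root V E, y) \<in> E ^^ n" by blast
    from step(2) show ?case unfolding adjacent_def
    proof
      assume "(y, z) \<in> E"
      with n have "(tree_root V E, z) \<in> E ^^ Suc n" by auto
      then show ?thesis by blast
    next
      assume zy: "(z, y) \<in> E"
      then obtain m where "n = Suc m"
        using n root_no_parent by (cases n) auto
      then obtain x where "(tree_root V E, x) \<in> E ^^ m" "(x, y) \<in> E"
        using n by auto
      then show ?thesis using parent_unique[OF _ zy] by blast
    qed
  qed
qed

text \<open>
  Following the unique parents backwards, two paths to \<open>v\<close> agree until one of them arrives at the
  root; the other one then ends there too, the root having no parent.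
\<close>

lemma path_length_unique:
  "(tree_root V E, v) \<in> E ^^ m \<Longrightarrow> (tree_root V E, v) \<in> E ^^ n \<Longrightarrow> m = n"
proof (induction m arbitrary: n v)
  case 0
  then show ?case using root_no_parent by (cases n) auto
next
  case (Suc m)
  then obtain x where x: "(tree_root V E, x) \<in> E ^^ m" "(x, v) \<in> E" by auto
  then obtain k where k: "n = Suc k"
    using Suc.prems(2) root_no_parent by (cases n) auto
  with Suc.prems(2) obtain y where y: "(tree_root V E, y) \<in> E ^^ k" "(y, v) \<in> E" by auto
  then have "y = x" using x(2) parent_unique by blast
  with Suc.IH x y k show ?case by blast
qed

lemma level_iff: "v \<in> level V E n \<longleftrightarrow> (tree_root V E, v) \<in> E ^^ n"
proof -
  have depth: "depth V E v = k" if "(tree_root V E, v) \<in> E ^^ k" for k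
    unfolding depth_def using that path_length_unique by (intro the_equality) blast+
  have "v \<in> V" if "(tree_root V E, v) \<in> E ^^ n"
    using that root_in_V edge_in_V by (cases n) auto
  then show ?thesis
    unfolding level_def using depth reachable_from_root by blast
qed

lemma level_Suc: "level V E (Suc n) = (\<Union>v\<in>level V E n. children E v)"
  by (fastforce simp: level_iff children_def)

lemma level_subset: "level V E n \<subseteq> V"
  by (auto simp: level_def)

lemma finite_level: "finite (level V E n)"
proof (induction n)
  case 0
  have "level V E 0 = {tree_root V E}" by (auto simp: level_iff)
  then show ?case by simp
next
  case (Suc n)
  then show ?case
    using locally_finite level_subset
    unfolding level_Suc locally_finite_tree_def by blast
qed

lemma level_nonempty: "level V E n \<noteq> {}"
proof (induction n)
  case 0
  have "tree_root V E \<in> level V E 0" by (simp add: level_iff)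
  then show ?case by blast
next
  case (Suc n)
  then show ?case
    using leafless level_subset[of n] unfolding level_Suc leafless_def by blast
qed

lemma level_card_pos: "0 < level_card V E n"
  unfolding level_card_def using finite_level level_nonempty by (simp add: card_gt_0_iff)

lemma sum_level_Suc:
  "(\<Sum>u\<in>level V E (Suc n). g u) = (\<Sum>v\<in>level V E n. \<Sum>u\<in>children E v. g u)"
  unfolding level_Suc
proof (rule sum.UNION_disjoint[OF finite_level])
  show "\<forall>v\<in>level V E n. finite (children E v)"
    using locally_finite level_subset unfolding locally_finite_tree_def by blast
  show "\<forall>v\<in>level V E n. \<forall>w\<in>level V E n. v \<noteq> w \<longrightarrow> children E v \<inter> children E w = {}"
    using parent_unique unfolding children_def by blast
qed

lemma level_disjoint: "v \<in> level V E m \<Longrightarrow> v \<in> level V E n \<longleftrightarrow> m = n"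
  by (auto simp: level_def)

section \<open>The Cesaro norm\<close>

lemma level_avg_nonneg: "0 \<le> level_avg V E n f"
  unfolding level_avg_def by (simp add: sum_nonneg)

lemma ces_mean_nonneg: "0 \<le> ces_mean V E n f"
  unfolding ces_mean_def by (simp add: sum_nonneg level_avg_nonneg)

lemma ces_mean_scale: "ces_mean V E n (\<lambda>v. c * f v) = cmod c * ces_mean V E n f"
proof -
  have "level_avg V E r (\<lambda>v. c * f v) = cmod c * level_avg V E r f" for r
    unfolding level_avg_def by (simp add: norm_mult sum_distrib_left[symmetric])
  then show ?thesis
    unfolding ces_mean_def by (simp add: sum_distrib_left[symmetric])
qed

lemma Ces_norm_nonneg: "0 \<le> Ces_norm p V E f"
  unfolding Ces_norm_def by simp

lemma Ces_vanishes: "f \<in> Ces p V E \<Longrightarrow> v \<notin> V \<Longrightarrow> f v = 0"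
  by (simp add: Ces_def)

text \<open>
  The norm is monotone in the sequence of Cesaro means, also when these are compared with a
  shifted sequence, because the omitted initial terms of the \<open>p\<close>-sum are nonnegative.
\<close>

lemma Ces_dominated:
  assumes f: "f \<in> Ces p V E" and g: "\<And>v. v \<notin> V \<Longrightarrow> g v = 0"
    and "0 < p" and "0 \<le> a"
    and le: "\<And>n. ces_mean V E n g \<le> a * ces_mean V E (n + k) f"
  shows "g \<in> Ces p V E" and "Ces_norm p V E g \<le> a * Ces_norm p V E f"
proof -
  let ?F = "\<lambda>n. ces_mean V E n f powr p"
  let ?G = "\<lambda>n. ces_mean V E n g powr p"
  have F: "summable ?F" using f by (simp add: Ces_def)
  then have F_shift: "summable (\<lambda>n. a powr p * ?F (n + k))"
    by (intro summable_mult summable_ignore_initial_segment)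
  have GF: "?G n \<le> a powr p * ?F (n + k)" for n
  proof -
    have "?G n \<le> (a * ces_mean V E (n + k) f) powr p"
      using \<open>0 < p\<close> by (intro powr_mono2 le ces_mean_nonneg) simp
    also have "\<dots> = a powr p * ?F (n + k)"
      by (rule powr_mult)
    finally show ?thesis .
  qed
  have G: "summable ?G"
    by (rule summable_comparison_test'[OF F_shift, of 0]) (simp add: GF)
  then show "g \<in> Ces p V E" using g by (simp add: Ces_def)
  have "suminf ?G \<le> (\<Sum>n. a powr p * ?F (n + k))"
    by (rule suminf_le[OF GF G F_shift])
  also have "\<dots> = a powr p * (\<Sum>n. ?F (n + k))"
    by (rule suminf_mult) (use F in \<open>rule summable_ignore_initial_segment\<close>)
  also have "\<dots> \<le> a powr p * suminf ?F"
    unfolding suminf_minus_initial_segment[OF F]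
    by (intro mult_left_mono) (simp_all add: sum_nonneg)
  finally have "suminf ?G powr (1 / p) \<le> (a powr p * suminf ?F) powr (1 / p)"
    using \<open>0 < p\<close> by (intro powr_mono2 suminf_nonneg G) simp_all
  also have "\<dots> = (a powr p) powr (1 / p) * suminf ?F powr (1 / p)"
    by (rule powr_mult)
  also have "(a powr p) powr (1 / p) = a"
    using \<open>0 < p\<close> \<open>0 \<le> a\<close> by (simp add: powr_powr)
  finally show "Ces_norm p V E g \<le> a * Ces_norm p V E f"
    unfolding Ces_norm_def .
qed

lemma Ces_scale:
  assumes f: "f \<in> Ces p V E" and "0 < p"
  shows "(\<lambda>v. c * f v) \<in> Ces p V E"
    and "Ces_norm p V E (\<lambda>v. c * f v) \<le> cmod c * Ces_norm p V E f"
proof -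
  have vanishes: "c * f v = 0" if "v \<notin> V" for v
    using Ces_vanishes[OF f that] by simp
  have mean: "ces_mean V E n (\<lambda>v. c * f v) \<le> cmod c * ces_mean V E (n + 0) f" for n
    by (simp add: ces_mean_scale)
  show "(\<lambda>v. c * f v) \<in> Ces p V E"
    by (rule Ces_dominated(1)[OF f vanishes \<open>0 < p\<close> norm_ge_zero mean])
  show "Ces_norm p V E (\<lambda>v. c * f v) \<le> cmod c * Ces_norm p V E f"
    by (rule Ces_dominated(2)[OF f vanishes \<open>0 < p\<close> norm_ge_zero mean])
qed

text \<open>
  The reverse of the preceding inequality comes from applying it to \<open>c f\<close> and the scalar
  \<open>1 / c\<close>, which give \<open>f\<close> back.
\<close>

lemma Ces_norm_scale:
  assumes f: "f \<in> Ces p V E" and "0 < p"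
  shows "Ces_norm p V E (\<lambda>v. c * f v) = cmod c * Ces_norm p V E f"
proof (cases "c = 0")
  case True
  then show ?thesis
    using Ces_scale(2)[OF f \<open>0 < p\<close>, of 0] Ces_norm_nonneg[of p "\<lambda>v. 0"] by simp
next
  case False
  have "Ces_norm p V E (\<lambda>v. (1 / c) * (c * f v)) \<le>
      cmod (1 / c) * Ces_norm p V E (\<lambda>v. c * f v)"
    by (rule Ces_scale(2)[OF Ces_scale(1)[OF f \<open>0 < p\<close>] \<open>0 < p\<close>])
  then have "cmod c * Ces_norm p V E f \<le> Ces_norm p V E (\<lambda>v. c * f v)"
    using False by (simp add: norm_divide field_simps)
  then show ?thesis
    using Ces_scale(2)[OF f \<open>0 < p\<close>, of c] by linarith
qed

lemma zero_in_Ces: "(\<lambda>v. 0) \<in> Ces p V E"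
  and Ces_norm_zero: "Ces_norm p V E (\<lambda>v. 0) = 0"
  by (simp_all add: Ces_def Ces_norm_def ces_mean_def level_avg_def)

section \<open>Indicator functions of vertices\<close>

abbreviation vertex_indicator :: "'v \<Rightarrow> 'v \<Rightarrow> complex" where
  "vertex_indicator u \<equiv> (\<lambda>v. if v = u then 1 else 0)"

lemma ces_mean_indicator:
  assumes u: "u \<in> level V E r"
  shows "ces_mean V E n (vertex_indicator u) =
    (if r \<le> n then 1 / ((real n + 1) * real (level_card V E r)) else 0)"
proof -
  have avg: "level_avg V E k (vertex_indicator u) =
      (if k = r then 1 / real (level_card V E r) else 0)" for k
  proof -
    have "(\<Sum>v\<in>level V E k. cmod (vertex_indicator u v)) =
        (\<Sum>v\<in>level V E k. if v = u then 1 else 0)"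
      by (intro sum.cong) auto
    also have "\<dots> = (if k = r then 1 else 0)"
      using u by (auto simp: finite_level level_disjoint)
    finally show ?thesis by (simp add: level_avg_def)
  qed
  show ?thesis
    unfolding ces_mean_def avg by simp
qed

lemma indicator_in_Ces:
  assumes u: "u \<in> level V E r" and "1 < p"
  shows "vertex_indicator u \<in> Ces p V E"
proof -
  have "summable (\<lambda>n. real n powr - p)"
    using \<open>1 < p\<close> by (simp add: summable_real_powr_iff)
  then have summable: "summable (\<lambda>n. real (n + 1) powr - p)"
    by (rule summable_ignore_initial_segment)
  have "summable (\<lambda>n. ces_mean V E n (vertex_indicator u) powr p)"
  proof (rule summable_comparison_test'[OF summable, of 0])
    fix n :: nat
    have card: "1 \<le> real (level_card V E r)"
      using level_card_pos[of r] by simp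
    have "ces_mean V E n (vertex_indicator u) \<le> 1 / (real n + 1)"
      using card unfolding ces_mean_indicator[OF u] by (auto intro!: frac_le)
    then have "ces_mean V E n (vertex_indicator u) powr p \<le> (1 / (real n + 1)) powr p"
      using \<open>1 < p\<close> by (intro powr_mono2 ces_mean_nonneg) simp
    also have "\<dots> = real (n + 1) powr - p"
      by (simp add: powr_divide powr_minus_divide add.commute)
    finally show "norm (ces_mean V E n (vertex_indicator u) powr p) \<le> real (n + 1) powr - p"
      by simp
  qed
  then show ?thesis
    using u level_subset by (auto simp: Ces_def)
qed

lemma Ces_norm_indicator_pos:
  assumes u: "u \<in> level V E r" and "1 < p"
  shows "0 < Ces_norm p V E (vertex_indicator u)"
proof -
  have "0 < ces_mean V E r (vertex_indicator u) powr p"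
    using level_card_pos[of r] by (simp add: ces_mean_indicator[OF u] add_nonneg_eq_0_iff)
  moreover have "summable (\<lambda>n. ces_mean V E n (vertex_indicator u) powr p)"
    using indicator_in_Ces[OF assms] by (simp add: Ces_def)
  ultimately have "0 < (\<Sum>n. ces_mean V E n (vertex_indicator u) powr p)"
    by (intro suminf_pos2) simp_all
  then show ?thesis by (simp add: Ces_norm_def)
qed

section \<open>The weighted backward shift\<close>

lemma backward_shift_outside:
  assumes "v \<notin> V"
  shows "backward_shift E lam f v = 0"
proof -
  have "children E v = {}" using assms edge_in_V by (auto simp: children_def)
  then show ?thesis by (simp add: backward_shift_def)
qed

lemma backward_shift_indicator:
  assumes "(v, u) \<in> E"
  shows "backward_shift E lam (vertex_indicator u) = (\<lambda>x. lam u * vertex_indicator v x)"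
proof
  fix x
  show "backward_shift E lam (vertex_indicator u) x = lam u * vertex_indicator v x"
  proof (cases "x \<in> V")
    case True
    then have "finite (children E x)"
      using locally_finite by (simp add: locally_finite_tree_def)
    moreover have "u \<in> children E x \<longleftrightarrow> x = v"
      using assms parent_unique by (auto simp: children_def)
    ultimately show ?thesis by (simp add: backward_shift_def if_distrib cong: if_cong)
  next
    case False
    then show ?thesis using assms edge_in_V by (auto simp: backward_shift_outside)
  qed
qed

abbreviation level_weight :: "('v \<Rightarrow> complex) \<Rightarrow> nat \<Rightarrow> real" where
  "level_weight lam r \<equiv> real (level_card V E (Suc r)) / real (level_card V E r) *
     Max ((\<lambda>u. cmod (lam u)) ` level V E (Suc r))"

lemma cmod_le_Max_level:
  "u \<in> level V E r \<Longrightarrow> cmod (lam u) \<le> Max ((\<lambda>u. cmod (lam u)) ` level V E r)"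
  by (simp add: finite_level)

lemma level_weight_nonneg: "0 \<le> level_weight lam r"
proof -
  obtain u where "u \<in> level V E (Suc r)" using level_nonempty by blast
  then have "0 \<le> Max ((\<lambda>u. cmod (lam u)) ` level V E (Suc r))"
    using cmod_le_Max_level norm_ge_zero order_trans by blast
  then show ?thesis by simp
qed

text \<open>
  Every vertex of level \<open>r + 1\<close> is a child of exactly one vertex of level \<open>r\<close>, so after the
  triangle inequality each \<open>|f u|\<close> is counted once; the quotient of cardinalities in the weight
  converts the normalisation of one level into that of the other.
\<close>

lemma level_avg_backward_shift_le:
  "level_avg V E r (backward_shift E lam f) \<le> level_weight lam r * level_avg V E (Suc r) f"
proof -
  let ?m = "Max ((\<lambda>u. cmod (lam u)) ` level V E (Suc r))"
  have "(\<Sum>v\<in>level V E r. cmod (backward_shift E lam f v)) \<le>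
      (\<Sum>v\<in>level V E r. \<Sum>u\<in>children E v. cmod (lam u * f u))"
    unfolding backward_shift_def by (intro sum_mono norm_sum)
  also have "\<dots> = (\<Sum>u\<in>level V E (Suc r). cmod (lam u * f u))"
    by (rule sum_level_Suc[symmetric])
  also have "\<dots> \<le> (\<Sum>u\<in>level V E (Suc r). ?m * cmod (f u))"
    unfolding norm_mult by (intro sum_mono mult_right_mono cmod_le_Max_level) auto
  also have "\<dots> = ?m * (\<Sum>u\<in>level V E (Suc r). cmod (f u))"
    by (rule sum_distrib_left[symmetric])
  finally show ?thesis
    using level_card_pos[of r] level_card_pos[of "Suc r"]
    unfolding level_avg_def by (simp add: field_simps)
qed

text \<open>
  The factor \<open>2\<close> is the largest value of \<open>(n + 2) / (n + 1)\<close>, which compares the divisors of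
  the two Cesaro means and is attained at \<open>n = 0\<close>.
\<close>

lemma ces_mean_backward_shift_le:
  assumes L: "\<And>r. level_weight lam r \<le> L"
  shows "ces_mean V E n (backward_shift E lam f) \<le> (2 * L) * ces_mean V E (n + 1) f"
proof -
  have "0 \<le> L" using L[of 0] level_weight_nonneg[of 0 lam] by linarith
  have "(\<Sum>r\<le>n. level_avg V E r (backward_shift E lam f)) \<le>
      (\<Sum>r\<le>n. L * level_avg V E (Suc r) f)"
    by (intro sum_mono order_trans[OF level_avg_backward_shift_le]
        mult_right_mono L level_avg_nonneg)
  also have "\<dots> = L * (\<Sum>r\<le>n. level_avg V E (Suc r) f)"
    by (rule sum_distrib_left[symmetric])
  also have "\<dots> \<le> L * (\<Sum>r\<le>Suc n. level_avg V E r f)"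
    unfolding sum.atMost_Suc_shift using \<open>0 \<le> L\<close> level_avg_nonneg
    by (intro mult_left_mono) auto
  finally have sum: "(\<Sum>r\<le>n. level_avg V E r (backward_shift E lam f)) \<le>
      L * (\<Sum>r\<le>Suc n. level_avg V E r f)" .
  have "ces_mean V E n (backward_shift E lam f) \<le>
      1 / (real n + 1) * (L * (\<Sum>r\<le>Suc n. level_avg V E r f))"
    unfolding ces_mean_def using sum by (intro mult_left_mono) auto
  also have "\<dots> \<le> 2 / (real n + 2) * (L * (\<Sum>r\<le>Suc n. level_avg V E r f))"
    using \<open>0 \<le> L\<close>
    by (intro mult_right_mono mult_nonneg_nonneg sum_nonneg level_avg_nonneg)
      (simp_all add: field_simps)
  also have "\<dots> = (2 * L) * ces_mean V E (n + 1) f"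
    unfolding ces_mean_def by (simp add: add.commute)
  finally show ?thesis .
qed

lemma backward_shift_upper_bound:
  assumes L: "\<And>r. level_weight lam r \<le> L" and f: "f \<in> Ces p V E" and "0 < p"
  shows "backward_shift E lam f \<in> Ces p V E"
    and "Ces_norm p V E (backward_shift E lam f) \<le> 2 * L * Ces_norm p V E f"
proof -
  have "0 \<le> L" using L[of 0] level_weight_nonneg[of 0 lam] by linarith
  then have "0 \<le> 2 * L" by simp
  note mean = ces_mean_backward_shift_le[OF L]
  show "backward_shift E lam f \<in> Ces p V E"
    by (rule Ces_dominated(1)[OF f backward_shift_outside \<open>0 < p\<close> \<open>0 \<le> 2 * L\<close> mean])
  show "Ces_norm p V E (backward_shift E lam f) \<le> 2 * L * Ces_norm p V E f"
    by (rule Ces_dominated(2)[OF f backward_shift_outside \<open>0 < p\<close> \<open>0 \<le> 2 * L\<close> mean])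
qed

lemma bounded_backward_shift:
  assumes L: "\<And>r. level_weight lam r \<le> L" and "0 < p"
  shows "bounded_operator_on (Ces p V E) (Ces_norm p V E) (backward_shift E lam)"
proof -
  have add: "backward_shift E lam (\<lambda>v. f v + g v) =
      (\<lambda>v. backward_shift E lam f v + backward_shift E lam g v)" for f g
    by (simp add: backward_shift_def sum.distrib distrib_left)
  have scale: "backward_shift E lam (\<lambda>v. c * f v) = (\<lambda>v. c * backward_shift E lam f v)" for c f
    by (simp add: backward_shift_def sum_distrib_left mult.left_commute)
  show ?thesis
    unfolding bounded_operator_on_def
    using backward_shift_upper_bound[OF L _ \<open>0 < p\<close>] add scale by blast
qed

lemma operator_norm_backward_shift_le:
  assumes L: "\<And>r. level_weight lam r \<le> L" and "0 < p"
  shows "operator_norm_on (Ces p V E) (Ces_norm p V E) (backward_shift E lam) \<le> 2 * L"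
  unfolding operator_norm_on_def
proof (rule cSup_least)
  show "{Ces_norm p V E (backward_shift E lam f) |f. f \<in> Ces p V E \<and> Ces_norm p V E f \<le> 1} \<noteq> {}"
    using zero_in_Ces Ces_norm_zero by (metis (mono_tags, lifting) empty_Collect_eq zero_le_one)
next
  fix x
  assume "x \<in> {Ces_norm p V E (backward_shift E lam f) |f. f \<in> Ces p V E \<and> Ces_norm p V E f \<le> 1}"
  then obtain f where x: "x = Ces_norm p V E (backward_shift E lam f)"
    and f: "f \<in> Ces p V E" "Ces_norm p V E f \<le> 1" by blast
  have "0 \<le> 2 * L" using L[of 0] level_weight_nonneg[of 0 lam] by linarith
  then have "2 * L * Ces_norm p V E f \<le> 2 * L * 1"
    using f(2) by (intro mult_left_mono)
  then show "x \<le> 2 * L"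
    using backward_shift_upper_bound(2)[OF L f(1) \<open>0 < p\<close>] x by simp
qed

text \<open>
  Tested on indicators: the image of the indicator of \<open>u\<close> starts one level earlier and its Cesaro
  means dominate those of the indicator of \<open>u\<close> scaled by the factor at issue.
\<close>

lemma vertex_weight_le_operator_norm:
  assumes bounded: "bounded_operator_on (Ces p V E) (Ces_norm p V E) (backward_shift E lam)"
    and "1 < p" and u: "u \<in> level V E (Suc r)"
  shows "real (level_card V E (Suc r)) / real (level_card V E r) * cmod (lam u) \<le>
    operator_norm_on (Ces p V E) (Ces_norm p V E) (backward_shift E lam)"
proof -
  obtain v where v: "v \<in> level V E r" "(v, u) \<in> E"
    using u unfolding level_Suc children_def by blast
  define w where
    "w = real (level_card V E (Suc r)) / real (level_card V E r) * cmod (lam u)"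
  have "0 \<le> w" by (simp add: w_def)
  then have cmod_w: "cmod (complex_of_real w) = w" by simp
  let ?N = "Ces_norm p V E"
  let ?B = "backward_shift E lam"
  let ?f = "vertex_indicator u"
  note f = indicator_in_Ces[OF u \<open>1 < p\<close>] and pos = Ces_norm_indicator_pos[OF u \<open>1 < p\<close>]
  have "0 < p" using \<open>1 < p\<close> by simp
  have "?B ?f \<in> Ces p V E"
    using bounded f unfolding bounded_operator_on_def by blast
  then have "?N (\<lambda>x. complex_of_real w * ?f x) \<le> 1 * ?N (?B ?f)"
  proof (rule Ces_dominated(2)[where k = 0])
    show "complex_of_real w * ?f x = 0" if "x \<notin> V" for x
      using that u level_subset by auto
    show "ces_mean V E n (\<lambda>x. complex_of_real w * ?f x) \<le> 1 * ces_mean V E (n + 0) (?B ?f)" for n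
      using level_card_pos[of r] level_card_pos[of "Suc r"]
      unfolding ces_mean_scale cmod_w backward_shift_indicator[OF v(2)]
        ces_mean_indicator[OF u] ces_mean_indicator[OF v(1)]
      by (simp add: w_def)
  qed (use \<open>0 < p\<close> in simp_all)
  then have "w * ?N ?f \<le> ?N (?B ?f)"
    by (simp only: Ces_norm_scale[OF f \<open>0 < p\<close>] cmod_w mult_1)
  also have "\<dots> \<le> operator_norm_on (Ces p V E) ?N ?B * ?N ?f"
  proof (rule operator_norm_on_bound[OF bounded _ _ _ f pos])
    show "0 \<le> ?N g" for g by (rule Ces_norm_nonneg)
    show "(\<lambda>x. c * g x) \<in> Ces p V E" "?N (\<lambda>x. c * g x) = cmod c * ?N g"
      if "g \<in> Ces p V E" for c g
      using that \<open>0 < p\<close> by (rule Ces_scale(1), rule Ces_norm_scale)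
  qed
  finally have "w \<le> operator_norm_on (Ces p V E) ?N ?B"
    using pos by (rule mult_right_le_imp_le)
  then show ?thesis
    by (simp only: w_def)
qed

lemma shift_const_le_operator_norm:
  assumes "bounded_operator_on (Ces p V E) (Ces_norm p V E) (backward_shift E lam)" and "1 < p"
  shows "shift_const V E lam \<le>
    ereal (operator_norm_on (Ces p V E) (Ces_norm p V E) (backward_shift E lam))"
  unfolding shift_const_def
proof (rule SUP_least)
  fix r
  let ?S = "(\<lambda>u. cmod (lam u)) ` level V E (Suc r)"
  have "Max ?S \<in> ?S"
    using finite_level level_nonempty by (intro Max_in) auto
  then obtain u where "u \<in> level V E (Suc r)" "Max ?S = cmod (lam u)" by blast
  with vertex_weight_le_operator_norm[OF assms]
  show "ereal (level_weight lam r) \<le>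
      ereal (operator_norm_on (Ces p V E) (Ces_norm p V E) (backward_shift E lam))"
    by simp
qed

lemma finite_shift_const_real:
  assumes "shift_const V E lam < \<infinity>"
  obtains L where "shift_const V E lam = ereal L" and "\<And>r. level_weight lam r \<le> L"
proof -
  have upper: "ereal (level_weight lam r) \<le> shift_const V E lam" for r
    unfolding shift_const_def by (rule SUP_upper) simp
  then obtain L where L: "shift_const V E lam = ereal L"
    using assms by (cases "shift_const V E lam") auto
  then show ?thesis using that upper by simp
qed

end

theorem theorem2p7:
  fixes V :: "'v set" and E :: "('v \<times> 'v) set" and p :: real and lam :: "'v \<Rightarrow> complex"
  assumes "directed_tree V E" and "rooted V E" and "leafless V E" and "locally_finite_tree V E"
    and "1 < p"
  shows "(bounded_operator_on (Ces p V E) (Ces_norm p V E) (backward_shift E lam)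
            \<longleftrightarrow> shift_const V E lam < \<infinity>) \<and>
         (bounded_operator_on (Ces p V E) (Ces_norm p V E) (backward_shift E lam) \<longrightarrow>
            shift_const V E lam \<le>
              ereal (operator_norm_on (Ces p V E) (Ces_norm p V E) (backward_shift E lam)) \<and>
            ereal (operator_norm_on (Ces p V E) (Ces_norm p V E) (backward_shift E lam))
              \<le> 2 * shift_const V E lam)"
proof -
  interpret leafless_rooted_tree V E
    by (unfold_locales) (fact assms)+
  have "0 < p" using \<open>1 < p\<close> by simp
  let ?bounded = "bounded_operator_on (Ces p V E) (Ces_norm p V E) (backward_shift E lam)"
  let ?norm = "operator_norm_on (Ces p V E) (Ces_norm p V E) (backward_shift E lam)"
  have lower: "shift_const V E lam \<le> ereal ?norm" if ?bounded
    using that \<open>1 < p\<close> by (rule shift_const_le_operator_norm)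
  have finite: "shift_const V E lam < \<infinity>" if ?bounded
    using le_less_trans[OF lower[OF that], of "\<infinity>"] by simp
  have bounded: ?bounded and upper: "ereal ?norm \<le> 2 * shift_const V E lam"
    if "shift_const V E lam < \<infinity>"
  proof -
    obtain L where L: "shift_const V E lam = ereal L" "\<And>r. level_weight lam r \<le> L"
      using finite_shift_const_real[OF \<open>shift_const V E lam < \<infinity>\<close>] by blast
    show ?bounded
      using L(2) \<open>0 < p\<close> by (rule bounded_backward_shift)
    have "ereal ?norm \<le> ereal (2 * L)"
      using operator_norm_backward_shift_le[OF L(2) \<open>0 < p\<close>] by simp
    then show "ereal ?norm \<le> 2 * shift_const V E lam"
      by (simp add: L(1))
  qed
  show ?thesis
    using lower finite bounded upper by blast
qed

end
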